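(* Let $L,L'$ be two generic distinct lines in $\mathbb{P}^3$, and let $X\subseteq L$ and $X'\subseteq L'$ be generic finite sets of points with $|X|=|X'|=m\ge 2$. Then $\tau_{X\star X'}=m-1$ and $HF_{X\star X'}=HF_X\,HF_{X'}$, i.e. $HF_{X\star X'}(t)=HF_X(t)\,HF_{X'}(t)$ for all $t\geq 0$. Precisely: there is a nonempty Zariski open subset $W$ of the variety of pairs of lines in $\mathbb{P}^3$ such that for every $(L,L')\in W$ with $L\neq L'$ there is a nonempty Zariski open subset $U\subseteq L$ such that for every finite set $X\subseteq U$ with $|X|\ge2$ there is a nonempty Zariski open subset $U'\subseteq L'$ such that for every finite set $X'\subseteq U'$ with $|X'|=|X|=m$ one has $\tau_{X\star X'}=m-1$ and $HF_{X\star X'}(t)=HF_X(t)\,HF_{X'}(t)$ for all $t\geq 0$.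
   Context: Work over an algebraically closed field $\mathbb{K}$. For points $P=[p_0:\dots:p_3]$, $Q=[q_0:\dots:q_3]$ of $\mathbb{P}^3$, the Hadamard product is $P\star Q=[p_0q_0:\dots:p_3q_3]$, defined when not all $p_iq_i$ vanish. For finite sets $X,X'\subseteq\mathbb{P}^3$, $X\star X'$ is the finite set of all defined products $P\star P'$ with $P\in X$, $P'\in X'$. The variety of pairs of lines is $G\times G$, where $G$ is the Grassmannian of lines in $\mathbb{P}^3$. For a finite set $Z$ of points of $\mathbb{P}^3$, $I_Z\subseteq R=\mathbb{K}[x_0,x_1,x_2,x_3]$ is its radical homogeneous ideal, $HF_Z(t)=\dim_{\mathbb{K}}(R/I_Z)_t$ is its Hilbert function, and $\tau_Z=\min\{t\ge0: HF_Z(t)=|Z|\}$ is its regularity index. *)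

theory Defs
  imports
    "HOL-Analysis.Cartesian_Space"
    "HOL-Library.Poly_Mapping"
    "HOL-Library.Numeral_Type"
    "HOL-Algebra.QuotRing"
    "HOL-Algebra.Embedded_Algebras"
    "HOL-Algebra.Algebraic_Closure_Type"
begin

section \<open>Projective space\<close>

text \<open>
  \<open>('k, 'n) proj\<close> is the projective space of lines through the origin in \<open>'k ^ 'n\<close>; its
  dimension is \<open>CARD('n) - 1\<close>, so that \<open>('k, 4) proj\<close> is projective 3-space.
  \<open>Proj v\<close> is the point with homogeneous coordinates \<open>v\<close>; it is meaningful for \<open>v \<noteq> 0\<close> only.
\<close>

definition proj_rel :: "('k::field) ^ ('n::finite) \<Rightarrow> 'k ^ 'n \<Rightarrow> bool" where
  "proj_rel v w \<longleftrightarrow> v \<noteq> 0 \<and> w \<noteq> 0 \<and> (\<exists>c. c \<noteq> 0 \<and> w = c *s v)"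

lemma part_equivp_proj_rel: "part_equivp (proj_rel :: ('k::field) ^ ('n::finite) \<Rightarrow> 'k ^ 'n \<Rightarrow> bool)"
proof (rule part_equivpI)
  have "proj_rel (1 :: 'k ^ 'n) 1"
    unfolding proj_rel_def by (intro conjI exI[of _ 1]) (auto simp: vec_eq_iff)
  then show "\<exists>x :: 'k ^ 'n. proj_rel x x" ..
  show "symp (proj_rel :: 'k ^ 'n \<Rightarrow> 'k ^ 'n \<Rightarrow> bool)"
  proof (rule sympI)
    fix v w :: "'k ^ 'n"
    assume "proj_rel v w"
    then obtain c where c: "v \<noteq> 0" "w \<noteq> 0" "c \<noteq> 0" "w = c *s v"
      unfolding proj_rel_def by blast
    then have "v = inverse c *s w" by (simp add: vector_smult_assoc)
    with c show "proj_rel w v"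
      unfolding proj_rel_def by (metis nonzero_imp_inverse_nonzero)
  qed
  show "transp (proj_rel :: 'k ^ 'n \<Rightarrow> 'k ^ 'n \<Rightarrow> bool)"
  proof (rule transpI)
    fix u v w :: "'k ^ 'n"
    assume "proj_rel u v" "proj_rel v w"
    then obtain c d where "u \<noteq> 0" "w \<noteq> 0" "c \<noteq> 0" "d \<noteq> 0" "w = (d * c) *s u"
      unfolding proj_rel_def by (auto simp: vector_smult_assoc)
    then show "proj_rel u w"
      unfolding proj_rel_def by (metis no_zero_divisors)
  qed
qed

quotient_type (overloaded) ('k, 'n) proj = "('k::field) ^ ('n::finite)" / partial: proj_rel
  morphisms coords Proj
  by (rule part_equivp_proj_rel)

lemma Proj_eq_iff:
  assumes "v \<noteq> 0" "w \<noteq> 0"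
  shows "Proj v = Proj w \<longleftrightarrow> (\<exists>c. c \<noteq> 0 \<and> w = c *s v)"
proof -
  have refl: "proj_rel u u" if "u \<noteq> 0" for u :: "'a ^ 'b"
    using that unfolding proj_rel_def by (auto intro!: exI[of _ 1])
  have "proj_rel v w \<longleftrightarrow> Proj v = Proj w"
    using Quotient_rel[OF Quotient_proj, of v w] refl assms by blast
  then show ?thesis
    using assms by (simp add: proj_rel_def)
qed

lemma coords_nonzero: "coords P \<noteq> 0" and Proj_coords: "Proj (coords P) = P"
  using Quotient_rep_reflp[OF Quotient_proj, of P] Quotient_abs_rep[OF Quotient_proj, of P]
  by (auto simp: proj_rel_def)

lemma proj_cases:
  obtains v where "v \<noteq> 0" "P = Proj v"
  using coords_nonzero Proj_coords by metis

text \<open>A line is given by the set of its points.\<close>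

definition proj_line :: "('k::field, 'n::finite) proj set \<Rightarrow> bool" where
  "proj_line L \<longleftrightarrow> (\<exists>V. vec.subspace V \<and> vec.dim V = 2 \<and> L = Proj ` (V - {0}))"


section \<open>Hadamard products\<close>

text \<open>
  Multiplication on \<open>'k ^ 'n\<close> is componentwise.  The chosen coordinates \<open>coords\<close> are
  immaterial by \<open>hadamard_defined_Proj\<close> and \<open>hadamard_Proj\<close>.
\<close>

definition hadamard_defined :: "('k::field, 'n::finite) proj \<Rightarrow> ('k, 'n) proj \<Rightarrow> bool" where
  "hadamard_defined P Q \<longleftrightarrow> coords P * coords Q \<noteq> 0"

definition hadamard :: "('k::field, 'n::finite) proj \<Rightarrow> ('k, 'n) proj \<Rightarrow> ('k, 'n) proj" where
  "hadamard P Q = Proj (coords P * coords Q)"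

definition hadamard_set ::
  "('k::field, 'n::finite) proj set \<Rightarrow> ('k, 'n) proj set \<Rightarrow> ('k, 'n) proj set" (infixl \<open>\<star>\<close> 70) where
  "Z \<star> Z' = {T. \<exists>P\<in>Z. \<exists>Q\<in>Z'. hadamard_defined P Q \<and> T = hadamard P Q}"

lemma coords_mult:
  assumes "v \<noteq> 0" "w \<noteq> 0"
  shows "\<exists>c. c \<noteq> 0 \<and> coords (Proj v) * coords (Proj w) = c *s (v * w)"
proof -
  obtain c where c: "c \<noteq> 0" "coords (Proj v) = c *s v"
    using Proj_eq_iff[OF assms(1) coords_nonzero] Proj_coords by metis
  obtain d where d: "d \<noteq> 0" "coords (Proj w) = d *s w"
    using Proj_eq_iff[OF assms(2) coords_nonzero] Proj_coords by metis
  show ?thesis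
    using c d by (intro exI[of _ "c * d"]) (simp add: vec_eq_iff)
qed

lemma hadamard_defined_Proj:
  assumes "v \<noteq> 0" "w \<noteq> 0"
  shows "hadamard_defined (Proj v) (Proj w) \<longleftrightarrow> v * w \<noteq> 0"
  using coords_mult[OF assms] by (metis hadamard_defined_def vec.scale_eq_0_iff)

lemma hadamard_Proj:
  assumes "v \<noteq> 0" "w \<noteq> 0" "v * w \<noteq> 0"
  shows "hadamard (Proj v) (Proj w) = Proj (v * w)"
proof -
  obtain c where c: "c \<noteq> 0" "coords (Proj v) * coords (Proj w) = c *s (v * w)"
    using coords_mult[OF assms(1,2)] by blast
  then have "c *s (v * w) \<noteq> 0"
    using assms(3) by simp
  then show ?thesis
    unfolding hadamard_def c(2) using Proj_eq_iff[OF assms(3)] c(1) by metis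
qed


section \<open>Polynomials and the Zariski topology\<close>

text \<open>Polynomials in variables indexed by \<open>'v\<close>; a monomial is its exponent vector.\<close>

type_synonym ('v, 'k) mpoly = "('v \<Rightarrow>\<^sub>0 nat) \<Rightarrow>\<^sub>0 'k"

definition eval_mpoly :: "('v::finite, 'k::comm_ring_1) mpoly \<Rightarrow> 'k ^ 'v \<Rightarrow> 'k" where
  "eval_mpoly f v =
     (\<Sum>m\<in>Poly_Mapping.keys f. Poly_Mapping.lookup f m * (\<Prod>i\<in>UNIV. (v $ i) ^ Poly_Mapping.lookup m i))"

text \<open>The zero polynomial is homogeneous of every degree.\<close>

definition homogeneous :: "nat \<Rightarrow> ('v::finite, 'k::zero) mpoly \<Rightarrow> bool" where
  "homogeneous d f \<longleftrightarrow> (\<forall>m\<in>Poly_Mapping.keys f. (\<Sum>i\<in>UNIV. Poly_Mapping.lookup m i) = d)"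

definition bihomogeneous :: "nat \<Rightarrow> nat \<Rightarrow> ('v::finite + 'w::finite, 'k::zero) mpoly \<Rightarrow> bool" where
  "bihomogeneous d e f \<longleftrightarrow>
     (\<forall>m\<in>Poly_Mapping.keys f. (\<Sum>i\<in>UNIV. Poly_Mapping.lookup m (Inl i)) = d \<and>
                 (\<Sum>j\<in>UNIV. Poly_Mapping.lookup m (Inr j)) = e)"

text \<open>
  Both notions of vanishing are used for (bi)homogeneous polynomials only, where they do not
  depend on the choice of the homogeneous coordinates.
\<close>

definition vanishes_at :: "('n::finite, 'k::field) mpoly \<Rightarrow> ('k, 'n) proj \<Rightarrow> bool" where
  "vanishes_at f P \<longleftrightarrow> eval_mpoly f (coords P) = 0"

definition vanishes_at2 ::
  "('n::finite + 'm::finite, 'k::field) mpoly \<Rightarrow> ('k, 'n) proj \<times> ('k, 'm) proj \<Rightarrow> bool" where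
  "vanishes_at2 f = (\<lambda>(P, Q).
     eval_mpoly f (\<chi> i. case i of Inl j \<Rightarrow> coords P $ j | Inr j \<Rightarrow> coords Q $ j) = 0)"

definition zariski_closed :: "('k::field, 'n::finite) proj set \<Rightarrow> bool" where
  "zariski_closed C \<longleftrightarrow>
     (\<exists>F. (\<forall>f\<in>F. \<exists>d. homogeneous d f) \<and> C = {P. \<forall>f\<in>F. vanishes_at f P})"

definition zariski_closed2 :: "(('k::field, 'n::finite) proj \<times> ('k, 'm::finite) proj) set \<Rightarrow> bool" where
  "zariski_closed2 C \<longleftrightarrow>
     (\<exists>F. (\<forall>f\<in>F. \<exists>d e. bihomogeneous d e f) \<and> C = {PQ. \<forall>f\<in>F. vanishes_at2 f PQ})"

definition zariski_open_in :: "('k::field, 'n::finite) proj set \<Rightarrow> ('k, 'n) proj set \<Rightarrow> bool" where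
  "zariski_open_in Y U \<longleftrightarrow> (\<exists>C. zariski_closed C \<and> U = Y - C)"


section \<open>The variety of pairs of lines\<close>

text \<open>
  The Grassmannian of lines is embedded by Pluecker coordinates.  We keep all \<open>CARD('n)\<^sup>2\<close>
  coordinates \<open>a\<^sub>i b\<^sub>j - a\<^sub>j b\<^sub>i\<close> of the alternating matrix; up to sign, those with
  \<open>i < j\<close> are repeated and the others vanish, so the Grassmannian lies in a linear subspace (a
  projective 5-space if \<open>CARD('n) = 4\<close>) and the induced Zariski topology is the usual one.
\<close>

definition wedge :: "('k::field) ^ ('n::finite) \<Rightarrow> 'k ^ 'n \<Rightarrow> 'k ^ ('n \<times> 'n)" where
  "wedge a b = (\<chi> p. case p of (i, j) \<Rightarrow> a $ i * b $ j - a $ j * b $ i)"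

definition pluecker :: "('k::field, 'n::finite) proj set \<Rightarrow> ('k, 'n \<times> 'n) proj" where
  "pluecker L = (THE T. \<exists>a b. a \<noteq> 0 \<and> b \<noteq> 0 \<and> Proj a \<in> L \<and> Proj b \<in> L \<and> Proj a \<noteq> Proj b \<and>
                          T = Proj (wedge a b))"

definition zariski_open_line_pairs ::
  "(('k::field, 'n::finite) proj set \<times> ('k, 'n) proj set) set \<Rightarrow> bool" where
  "zariski_open_line_pairs W \<longleftrightarrow>
     (\<exists>C. zariski_closed2 C \<and>
          W = {(L, L'). proj_line L \<and> proj_line L' \<and> (pluecker L, pluecker L') \<notin> C})"

lemma wedge_nonzero:
  assumes "a \<noteq> 0" "b \<noteq> 0" "Proj a \<noteq> Proj b"
  shows "wedge a b \<noteq> 0"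
proof
  assume "wedge a b = 0"
  then have eq: "a $ i * b $ j = a $ j * b $ i" for i j
    by (auto simp: wedge_def vec_eq_iff)
  from assms(1) obtain i where i: "a $ i \<noteq> 0"
    by (auto simp: vec_eq_iff)
  have b: "b = (b $ i / a $ i) *s a"
    using eq[of i] i by (simp add: vec_eq_iff field_simps)
  with assms(2) have "b $ i / a $ i \<noteq> 0"
    by (metis vec.scale_zero_left)
  with b assms Proj_eq_iff show False by metis
qed

lemma Proj_in_line_iff:
  assumes "vec.subspace V" "v \<noteq> 0"
  shows "Proj v \<in> Proj ` (V - {0}) \<longleftrightarrow> v \<in> V"
proof
  assume "Proj v \<in> Proj ` (V - {0})"
  then obtain w where "w \<in> V" "w \<noteq> 0" "Proj w = Proj v" by force
  then show "v \<in> V"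
    using Proj_eq_iff[of w v] assms by (auto intro: vec.subspace_scale)
qed (use assms in auto)

lemma pluecker_eq:
  fixes L :: "('k::field, 'n::finite) proj set"
  assumes L: "proj_line L" and ab: "a \<noteq> 0" "b \<noteq> 0" "Proj a \<in> L" "Proj b \<in> L" "Proj a \<noteq> Proj b"
  shows "pluecker L = Proj (wedge a b)"
  unfolding pluecker_def
proof (rule the_equality)
  fix T :: "('k, 'n \<times> 'n) proj"
  assume "\<exists>a b. a \<noteq> 0 \<and> b \<noteq> 0 \<and> Proj a \<in> L \<and> Proj b \<in> L \<and> Proj a \<noteq> Proj b \<and> T = Proj (wedge a b)"
  then obtain c d where cd: "c \<noteq> 0" "d \<noteq> 0" "Proj c \<in> L" "Proj d \<in> L" "Proj c \<noteq> Proj d"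
    and T: "T = Proj (wedge c d)" by blast
  obtain V where V: "vec.subspace V" "vec.dim V = 2" "L = Proj ` (V - {0})"
    using L unfolding proj_line_def by blast
  have in_V: "a \<in> V" "b \<in> V" "c \<in> V" "d \<in> V"
    using ab cd Proj_in_line_iff[OF V(1)] unfolding V(3) by blast+
  have ne: "a \<noteq> b" using ab by auto
  have "a \<notin> vec.span {b}"
  proof
    assume "a \<in> vec.span {b}"
    then obtain k where k: "a = k *s b"
      by (auto simp: vec.span_singleton)
    with ab have "k \<noteq> 0" by auto
    with k ab Proj_eq_iff[of b a] show False by metis
  qed
  moreover have "vec.independent {b}"
    using ab by simp
  ultimately have ind: "vec.independent {a, b}"
    by (simp add: vec.independent_insert ne)
  have "V \<subseteq> vec.span {a, b}"
    by (rule vec.card_ge_dim_independent[OF _ ind]) (use in_V V ne in auto)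
  then obtain p q r s where pq: "c = p *s a + q *s b" and rs: "d = r *s a + s *s b"
    using in_V by (fastforce simp: vec.span_insert vec.span_singleton algebra_simps)
  have w: "wedge c d = (p * s - q * r) *s wedge a b"
    by (simp add: wedge_def vec_eq_iff pq rs algebra_simps)
  then have "p * s - q * r \<noteq> 0"
    using wedge_nonzero[OF cd(1,2,5)] by (metis vec.scale_zero_left)
  with w show "T = Proj (wedge a b)"
    unfolding T using Proj_eq_iff wedge_nonzero[OF cd(1,2,5)] wedge_nonzero[OF ab(1,2,5)] by metis
qed (use ab in blast)


section \<open>Hilbert function and regularity index\<close>

text \<open>The polynomial ring as an object of \<open>HOL-Algebra\<close>, with carrier \<open>UNIV\<close>.\<close>

abbreviation mpoly_ring :: "('v, 'k::comm_ring_1) mpoly ring" where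
  "mpoly_ring \<equiv> ring_of_type_algebra"

definition const_mpoly :: "'k::comm_ring_1 \<Rightarrow> ('v, 'k) mpoly" where
  "const_mpoly c = Poly_Mapping.single 0 c"

definition vanishing_ideal :: "('k::field, 'n::finite) proj set \<Rightarrow> ('n, 'k) mpoly set" where
  "vanishing_ideal Z =
     Idl\<^bsub>mpoly_ring\<^esub> {f. (\<exists>d. homogeneous d f) \<and> (\<forall>P\<in>Z. vanishes_at f P)}"

text \<open>
  \<open>(R/I\<^sub>Z)\<^sub>t\<close> is the set of classes of the forms of degree \<open>t\<close> in the quotient ring, and its
  dimension is taken over the image of the field of constants.
\<close>

definition hilbert_function :: "('k::field, 'n::finite) proj set \<Rightarrow> nat \<Rightarrow> nat" (\<open>HF\<close>) where
  "HF Z t =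
     (let R = mpoly_ring; I = vanishing_ideal Z
      in ring.dim (R Quot I)
           ((\<lambda>c. I +>\<^bsub>R\<^esub> const_mpoly c) ` UNIV)
           ((\<lambda>f. I +>\<^bsub>R\<^esub> f) ` {f. homogeneous t f}))"

definition regularity_index :: "('k::field, 'n::finite) proj set \<Rightarrow> nat" (\<open>\<tau>\<close>) where
  "\<tau> Z = (LEAST t. HF Z t = card Z)"

end

theory Submission
  imports Defs
begin

text \<open>
  If the lines \<open>L\<close> and \<open>L'\<close> are spanned by \<open>a, b\<close> and by \<open>c, d\<close>, the Hadamard product of a
  point of \<open>L\<close> and a point of \<open>L'\<close> is a bilinear expression in their coordinates with coefficient
  vectors \<open>a * c\<close>, \<open>a * d\<close>, \<open>b * c\<close>, \<open>b * d\<close>.  For generic lines these four vectors form a basis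
  of the four-dimensional space, and in this basis the Hadamard product is the Segre embedding of
  \<open>L \<times> L'\<close>.  The determinant of the four vectors is a bihomogeneous polynomial of bidegree \<open>(2, 2)\<close> in
  the Pluecker coordinates (\<open>cross_ratio_gap\<close>), so the condition is open, and an example shows
  that it can be satisfied.  Its use is \<open>segre_independent_if_gap\<close>: every product of a linear
  form on \<open>L\<close> and a linear form on \<open>L'\<close> is the restriction of a linear form on the ambient space.

  For such lines the lines themselves serve as the open subsets \<open>U\<close> and \<open>U'\<close>: the formula below
  holds for all finite nonempty sets \<open>Z \<subseteq> L\<close> and \<open>Z' \<subseteq> L'\<close>.  The Hilbert functions are computed by interpolation (\<open>hilbert_function_eq_card\<close>): \<open>HF Z t\<close> is the size of any subset \<open>S\<close>
  of \<open>Z\<close> whose points can be isolated by forms of degree \<open>t\<close> and such that a form of degree \<open>t\<close>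
  vanishing on \<open>S\<close> vanishes on \<open>Z\<close>.  On a line every subset with \<open>min (t + 1) |Z|\<close> elements
  qualifies, since a nonzero binary form of degree \<open>t\<close> has at most \<open>t\<close> zeros
  (\<open>hilbert_function_on_line\<close>).  On the Segre image the set \<open>S \<star> S'\<close> of products qualifies if \<open>S\<close> and
  \<open>S'\<close> do (\<open>hilbert_function_hadamard_set\<close>), and it has \<open>|S| |S'|\<close> elements because the Segre
  embedding is injective.  Hence
  \<open>HF (Z \<star> Z') t = min (t + 1) |Z| * min (t + 1) |Z'| = HF Z t * HF Z' t\<close>.  If \<open>|Z| = |Z'| = m\<close>,
  this reaches \<open>|Z \<star> Z'| = m\<^sup>2\<close> for the first time at \<open>t = m - 1\<close>.
\<close>

(* The symbol $ stands for the components of vectors only. *)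
unbundle no fps_syntax

section \<open>Evaluation and degree of polynomials\<close>

definition monomial_value :: "('v::finite \<Rightarrow>\<^sub>0 nat) \<Rightarrow> 'k::comm_ring_1 ^ 'v \<Rightarrow> 'k" where
  "monomial_value m v = (\<Prod>i\<in>UNIV. (v $ i) ^ Poly_Mapping.lookup m i)"

lemma monomial_value_add: "monomial_value (m + n) v = monomial_value m v * monomial_value n v"
  by (simp add: monomial_value_def lookup_add power_add prod.distrib)

lemma eval_mpoly_superset:
  assumes "finite A" "Poly_Mapping.keys f \<subseteq> A"
  shows "eval_mpoly f v = (\<Sum>m\<in>A. Poly_Mapping.lookup f m * monomial_value m v)"
  unfolding eval_mpoly_def monomial_value_def
  by (rule sum.mono_neutral_left) (use assms in \<open>auto simp: in_keys_iff\<close>)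

lemma eval_mpoly_add: "eval_mpoly (f + g) v = eval_mpoly f v + eval_mpoly g v"
proof -
  let ?A = "Poly_Mapping.keys f \<union> Poly_Mapping.keys g"
  have "eval_mpoly h v = (\<Sum>m\<in>?A. Poly_Mapping.lookup h m * monomial_value m v)"
    if "Poly_Mapping.keys h \<subseteq> ?A" for h
    using that by (intro eval_mpoly_superset) auto
  then show ?thesis
    using Poly_Mapping.keys_add[of f g] by (simp add: lookup_add algebra_simps sum.distrib)
qed

lemma eval_mpoly_0 [simp]: "eval_mpoly 0 v = 0"
  by (simp add: eval_mpoly_def)

lemma eval_mpoly_single: "eval_mpoly (Poly_Mapping.single m c) v = c * monomial_value m v"
  by (subst eval_mpoly_superset[of "{m}"]) auto

lemma eval_mpoly_const [simp]: "eval_mpoly (const_mpoly c) v = c"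
  by (simp add: const_mpoly_def eval_mpoly_single monomial_value_def)

lemma poly_mapping_add_induct [case_names zero single_add]:
  assumes "P 0" "\<And>a b f. P f \<Longrightarrow> P (Poly_Mapping.single a b + f)"
  shows "P (f :: 'a \<Rightarrow>\<^sub>0 'b::comm_monoid_add)"
proof (induction f rule: update_induct)
  case (update f a b)
  have "Poly_Mapping.update a b f = Poly_Mapping.single a b + f"
    using update(1) by (intro poly_mapping_eqI) (auto simp: lookup_update lookup_add lookup_single in_keys_iff)
  with update assms show ?case by simp
qed (fact assms(1))

lemma eval_mpoly_mult: "eval_mpoly (f * g) v = eval_mpoly f v * eval_mpoly g v"
proof (induction f rule: poly_mapping_add_induct)
  case (single_add a b f)
  have "eval_mpoly (Poly_Mapping.single a b * g) v = b * monomial_value a v * eval_mpoly g v"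
    by (induction g rule: poly_mapping_add_induct)
       (simp_all add: distrib_left eval_mpoly_add eval_mpoly_single mult_single monomial_value_add mult_ac)
  with single_add show ?case
    by (simp add: distrib_right eval_mpoly_add eval_mpoly_single)
qed simp

lemma eval_mpoly_diff: "eval_mpoly (f - g) v = eval_mpoly f v - eval_mpoly g v"
  using eval_mpoly_add[of "f - g" g v] by simp

lemma eval_mpoly_sum: "eval_mpoly (\<Sum>i\<in>A. f i) v = (\<Sum>i\<in>A. eval_mpoly (f i) v)"
  by (induction A rule: infinite_finite_induct) (auto simp: eval_mpoly_add)

lemma eval_mpoly_prod: "eval_mpoly (\<Prod>i\<in>A. f i) v = (\<Prod>i\<in>A. eval_mpoly (f i) v)"
proof -
  have "eval_mpoly 1 v = 1"
    using eval_mpoly_const[of 1 v] by (simp add: const_mpoly_def)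
  then show ?thesis
    by (induction A rule: infinite_finite_induct) (auto simp: eval_mpoly_mult)
qed

lemma homogeneous_0 [simp]: "homogeneous d 0"
  and homogeneous_const [simp]: "homogeneous 0 (const_mpoly c)"
  by (auto simp: homogeneous_def const_mpoly_def)

lemma homogeneous_add: "homogeneous d f \<Longrightarrow> homogeneous d g \<Longrightarrow> homogeneous d (f + g)"
  using Poly_Mapping.keys_add[of f g] unfolding homogeneous_def by blast

lemma homogeneous_sum: "(\<And>i. i \<in> A \<Longrightarrow> homogeneous d (f i)) \<Longrightarrow> homogeneous d (\<Sum>i\<in>A. f i)"
  by (induction A rule: infinite_finite_induct) (auto intro: homogeneous_add)

lemma homogeneous_mult: "homogeneous d f \<Longrightarrow> homogeneous e g \<Longrightarrow> homogeneous (d + e) (f * g)"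
  using keys_mult[of f g] unfolding homogeneous_def
  by (fastforce simp: lookup_add sum.distrib)

lemma homogeneous_scale: "homogeneous d f \<Longrightarrow> homogeneous d (const_mpoly c * f)"
  using homogeneous_mult[OF homogeneous_const] by fastforce

lemma homogeneous_diff:
  fixes f g :: "('v::finite, 'k::comm_ring_1) mpoly"
  assumes "homogeneous d f" "homogeneous d g"
  shows "homogeneous d (f - g)"
  using homogeneous_add[OF assms(1) homogeneous_scale[OF assms(2), of "-1"]]
  by (simp add: const_mpoly_def single_uminus)

lemma homogeneous_prod:
  fixes f :: "'i \<Rightarrow> ('v::finite, 'k::comm_ring_1) mpoly"
  assumes "finite A" "\<And>i. i \<in> A \<Longrightarrow> homogeneous 1 (f i)"
  shows "homogeneous (card A) (\<Prod>i\<in>A. f i)"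
  using assms
proof (induction A)
  case empty
  show ?case using homogeneous_const[of 1] by (simp add: const_mpoly_def)
next
  case (insert i A)
  then show ?case using homogeneous_mult[of 1 "f i" "card A" "\<Prod>i\<in>A. f i"] by simp
qed

lemma eval_mpoly_scale:
  assumes "homogeneous d f"
  shows "eval_mpoly f (c *s v) = c ^ d * eval_mpoly f v"
proof -
  have "monomial_value m (c *s v) = c ^ d * monomial_value m v" if "m \<in> Poly_Mapping.keys f" for m
    using assms that
    by (auto simp: homogeneous_def monomial_value_def power_mult_distrib prod.distrib simp flip: power_sum)
  then show ?thesis
    by (simp add: eval_mpoly_superset[OF finite_keys order_refl] sum_distrib_left mult_ac)
qed

lemma coeff_mult_of_degree_le:
  fixes p q :: "'a::comm_semiring_0 poly"
  assumes "Polynomial.degree p \<le> m" "Polynomial.degree q \<le> n"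
  shows "poly.coeff (p * q) (m + n) = poly.coeff p m * poly.coeff q n"
proof -
  have "poly.coeff (p * q) (m + n) = (\<Sum>i\<le>m + n. poly.coeff p i * poly.coeff q (m + n - i))"
    by (rule coeff_mult)
  also have "\<dots> = (\<Sum>i\<in>{m}. poly.coeff p i * poly.coeff q (m + n - i))"
  proof (rule sum.mono_neutral_right)
    show "\<forall>i\<in>{..m + n} - {m}. poly.coeff p i * poly.coeff q (m + n - i) = 0"
    proof
      fix i assume "i \<in> {..m + n} - {m}"
      then have "i > m \<or> m + n - i > n" by auto
      with assms show "poly.coeff p i * poly.coeff q (m + n - i) = 0"
        by (metis coeff_eq_0 le_less_trans mult_zero_left mult_zero_right)
    qed
  qed auto
  finally show ?thesis by simp
qed

text \<open>
  Substituting \<open>p + s q\<close> gives a polynomial in \<open>s\<close> whose coefficient of \<open>s\<^sup>d\<close> is the value at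
  \<open>q\<close>, the point where \<open>s\<close> is infinite.  This lets the usual bound on the number of roots
  count zeros on a projective line without treating the point at infinity separately.
\<close>

lemma homogeneous_on_line:
  fixes f :: "('v::finite, 'k::comm_ring_1) mpoly"
  assumes "homogeneous d f"
  obtains H :: "'k poly" where "Polynomial.degree H \<le> d" "poly.coeff H d = eval_mpoly f q"
    "\<And>s. poly H s = eval_mpoly f (p + s *s q)"
proof
  define M where "M m A = (\<Prod>i\<in>A. [:p $ i, q $ i:] ^ Poly_Mapping.lookup m i)" for m :: "'v \<Rightarrow>\<^sub>0 nat" and A
  define H where "H = (\<Sum>m\<in>Poly_Mapping.keys f. Polynomial.smult (Poly_Mapping.lookup f m) (M m UNIV))"
  have pow: "Polynomial.degree ([:a, b:] ^ n) \<le> n \<and> poly.coeff ([:a, b:] ^ n) n = b ^ n" for a b :: 'k and n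
  proof (induction n)
    case (Suc n)
    have "Polynomial.degree [:a, b:] \<le> 1" by simp
    with Suc show ?case
      using coeff_mult_of_degree_le[of "[:a, b:]" 1 "[:a, b:] ^ n" n] degree_mult_le[of "[:a, b:]" "[:a, b:] ^ n"]
      by (simp del: mult_pCons_left)
  qed simp
  have M: "Polynomial.degree (M m A) \<le> (\<Sum>i\<in>A. Poly_Mapping.lookup m i) \<and>
      poly.coeff (M m A) (\<Sum>i\<in>A. Poly_Mapping.lookup m i) = (\<Prod>i\<in>A. (q $ i) ^ Poly_Mapping.lookup m i)"
    if "finite A" for m A
    using that
  proof (induction A)
    case (insert i A)
    let ?x = "[:p $ i, q $ i:] ^ Poly_Mapping.lookup m i"
    have eq: "M m (insert i A) = ?x * M m A" using insert by (simp add: M_def)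
    show ?case
      unfolding eq
      using insert pow[of "p $ i" "q $ i" "Poly_Mapping.lookup m i"]
        coeff_mult_of_degree_le[of ?x "Poly_Mapping.lookup m i" "M m A" "\<Sum>i\<in>A. Poly_Mapping.lookup m i"]
        degree_mult_le[of ?x "M m A"]
      by simp
  qed (simp add: M_def)
  have M': "Polynomial.degree (M m UNIV) \<le> d" "poly.coeff (M m UNIV) d = (\<Prod>i\<in>UNIV. (q $ i) ^ Poly_Mapping.lookup m i)"
    if "m \<in> Poly_Mapping.keys f" for m
    using M[of UNIV m] assms that unfolding homogeneous_def by auto
  show "Polynomial.degree H \<le> d"
    unfolding H_def using M'(1) by (intro degree_sum_le) (auto intro: order_trans[OF degree_smult_le])
  show "poly.coeff H d = eval_mpoly f q"
    unfolding H_def eval_mpoly_def by (simp add: coeff_sum M'(2))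
  show "poly H s = eval_mpoly f (p + s *s q)" for s
    unfolding H_def eval_mpoly_def M_def by (simp add: poly_sum poly_prod)
qed

section \<open>Hilbert functions from interpolation\<close>

lemma mpoly_ring_simps [simp]:
  "carrier ring_of_type_algebra = UNIV"
  "x \<otimes>\<^bsub>ring_of_type_algebra\<^esub> y = x * y"
  "x \<oplus>\<^bsub>ring_of_type_algebra\<^esub> y = x + y"
  "\<one>\<^bsub>ring_of_type_algebra\<^esub> = 1"
  "\<zero>\<^bsub>ring_of_type_algebra\<^esub> = 0"
  by (simp_all add: ring_of_type_algebra_def)

lemma vanishing_ideal_ideal:
  fixes Z :: "('k::field, 'n::finite) proj set"
  shows "ideal (vanishing_ideal Z) mpoly_ring"
proof -
  interpret R: cring "mpoly_ring :: ('n, 'k) mpoly ring" by (rule cring_from_type_algebra)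
  show ?thesis unfolding vanishing_ideal_def by (rule R.genideal_ideal) simp
qed

text \<open>
  The polynomials that vanish at a fixed coordinate vector form an ideal containing the
  generators.  Together with \<open>vanishing_idealI\<close> this reduces membership of a form in the
  ideal of \<open>Z\<close> to its values at the points of \<open>Z\<close>.
\<close>

lemma vanishing_ideal_eval:
  fixes Z :: "('k::field, 'n::finite) proj set"
  assumes "f \<in> vanishing_ideal Z" "P \<in> Z"
  shows "eval_mpoly f (coords P) = 0"
proof -
  interpret R: cring "mpoly_ring :: ('n, 'k) mpoly ring" by (rule cring_from_type_algebra)
  have minus: "\<ominus>\<^bsub>mpoly_ring\<^esub> f = - f" for f :: "('n, 'k) mpoly"
    by (rule R.minus_equality) auto
  let ?J = "{f. eval_mpoly f (coords P) = 0}"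
  have "ideal ?J mpoly_ring"
  proof (rule idealI)
    show "subgroup ?J (add_monoid mpoly_ring)"
    proof (rule R.add.subgroupI)
      show "\<ominus>\<^bsub>mpoly_ring\<^esub> f \<in> ?J" if "f \<in> ?J" for f
        using that eval_mpoly_diff[of 0 f "coords P"] by (simp add: minus)
      show "?J \<noteq> {}" using eval_mpoly_0 by blast
    qed (auto simp: eval_mpoly_add)
  qed (auto simp: eval_mpoly_mult R.ring_axioms)
  then have "vanishing_ideal Z \<subseteq> ?J"
    unfolding vanishing_ideal_def
    by (rule R.genideal_minimal) (use assms(2) in \<open>auto simp: vanishes_at_def\<close>)
  with assms(1) show ?thesis by auto
qed

lemma vanishing_idealI:
  fixes Z :: "('k::field, 'n::finite) proj set"
  assumes "homogeneous d f" "\<And>P. P \<in> Z \<Longrightarrow> eval_mpoly f (coords P) = 0"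
  shows "f \<in> vanishing_ideal Z"
proof -
  interpret R: cring "mpoly_ring :: ('n, 'k) mpoly ring" by (rule cring_from_type_algebra)
  show ?thesis
    unfolding vanishing_ideal_def
    by (rule R.genideal_self[THEN subsetD]) (use assms in \<open>auto simp: vanishes_at_def\<close>)
qed

text \<open>
  All Hilbert functions below are computed by this criterion.  By \<open>sep\<close>, the classes of the
  forms \<open>f\<close> attached to the points of \<open>S\<close> are linearly independent, because evaluation at a
  point of \<open>S\<close> isolates one coefficient of a linear combination.  By \<open>det\<close> they span,
  because interpolating the values of a form on \<open>S\<close> leaves a remainder in the ideal.
\<close>

lemma hilbert_function_eq_card:
  fixes Z :: "('k::field, 'n::finite) proj set"
  assumes S: "finite S" "S \<subseteq> Z" and Z: "Z \<noteq> {}"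
    and sep: "\<And>P. P \<in> S \<Longrightarrow> \<exists>f. homogeneous t f \<and> eval_mpoly f (coords P) \<noteq> 0 \<and>
                (\<forall>Q\<in>S - {P}. eval_mpoly f (coords Q) = 0)"
    and det: "\<And>f P. homogeneous t f \<Longrightarrow> (\<forall>Q\<in>S. eval_mpoly f (coords Q) = 0) \<Longrightarrow> P \<in> Z \<Longrightarrow>
                eval_mpoly f (coords P) = 0"
  shows "HF Z t = card S"
proof -
  define R where "R = (mpoly_ring :: ('n, 'k) mpoly ring)"
  define I where "I = vanishing_ideal Z"
  define \<pi> where "\<pi> f = I +>\<^bsub>R\<^esub> f" for f
  interpret R: cring R unfolding R_def by (rule cring_from_type_algebra)
  interpret I: ideal I R unfolding R_def I_def by (rule vanishing_ideal_ideal)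
  interpret Q: ring "R Quot I" by (rule I.quotient_is_ring)
  interpret \<pi>: ring_hom_ring R "R Quot I" \<pi>
    unfolding \<pi>_def by (rule I.rcos_ring_hom_ring)
  have R_simps [simp]: "carrier R = UNIV" "x \<otimes>\<^bsub>R\<^esub> y = x * y" "x \<oplus>\<^bsub>R\<^esub> y = x + y"
    "\<one>\<^bsub>R\<^esub> = 1" "\<zero>\<^bsub>R\<^esub> = 0" for x y
    by (simp_all add: R_def)
  have \<pi>_eq_iff: "\<pi> f = \<pi> g \<longleftrightarrow> f - g \<in> I" for f g
  proof -
    have "f \<ominus>\<^bsub>R\<^esub> g = f - g"
      using R.minus_equality[of "- g" g] by (simp add: a_minus_def)
    then show ?thesis
      unfolding \<pi>_def using R.quotient_eq_iff_same_a_r_cos[OF I.ideal_axioms, of f g] by simp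
  qed

  \<comment> \<open>A nonzero constant does not vanish at a point of \<open>Z\<close>, so the constants embed into the
    quotient.\<close>
  define k where "k = \<pi> \<circ> const_mpoly"
  define K where "K = range k"
  have K: "subfield K (R Quot I)"
  proof -
    interpret F: field "ring_of_type_algebra :: 'k ring" by (rule field_from_type_algebra)
    interpret k: ring_hom_ring "ring_of_type_algebra :: 'k ring" "R Quot I" k
    proof (rule ring_hom_ringI)
      show "k (x \<otimes>\<^bsub>ring_of_type_algebra\<^esub> y) = k x \<otimes>\<^bsub>R Quot I\<^esub> k y"
        and "k (x \<oplus>\<^bsub>ring_of_type_algebra\<^esub> y) = k x \<oplus>\<^bsub>R Quot I\<^esub> k y" for x y
        using \<pi>.hom_mult[of "const_mpoly x" "const_mpoly y"] \<pi>.hom_add[of "const_mpoly x" "const_mpoly y"]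
        by (simp_all add: k_def const_mpoly_def mult_single single_add)
      show "k \<one>\<^bsub>ring_of_type_algebra\<^esub> = \<one>\<^bsub>R Quot I\<^esub>"
        using \<pi>.hom_one by (simp add: k_def const_mpoly_def)
    qed (use \<pi>.hom_closed in \<open>auto simp: F.ring_axioms Q.ring_axioms k_def\<close>)
    obtain P where "P \<in> Z" using Z by blast
    have "\<one>\<^bsub>R Quot I\<^esub> \<noteq> \<zero>\<^bsub>R Quot I\<^esub>"
    proof
      assume "\<one>\<^bsub>R Quot I\<^esub> = \<zero>\<^bsub>R Quot I\<^esub>"
      then have "\<pi> 1 = \<pi> 0"
        using \<pi>.hom_one \<pi>.hom_zero by simp
      then have "const_mpoly 1 \<in> I"
        by (simp add: \<pi>_eq_iff const_mpoly_def)
      from vanishing_ideal_eval[OF this[unfolded I_def] \<open>P \<in> Z\<close>] show False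
        by simp
    qed
    then show ?thesis
      using k.img_is_subfield(2)[OF F.carrier_is_subfield] by (simp add: K_def)
  qed

  define f where "f P = (SOME f. homogeneous t f \<and> eval_mpoly f (coords P) \<noteq> 0 \<and>
      (\<forall>Q\<in>S - {P}. eval_mpoly f (coords Q) = 0))" for P
  have f: "homogeneous t (f P)" "eval_mpoly (f P) (coords P) \<noteq> 0"
    "Q \<in> S \<Longrightarrow> Q \<noteq> P \<Longrightarrow> eval_mpoly (f P) (coords Q) = 0" if "P \<in> S" for P Q
    using someI_ex[OF sep[OF that]] unfolding f_def[symmetric] by auto
  define E where "E A = range (\<lambda>c. \<pi> (\<Sum>P\<in>A. const_mpoly (c P) * f P))" for A
  have eval_comb: "eval_mpoly (\<Sum>P\<in>A. const_mpoly (c P) * f P) (coords Q) =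
      (if Q \<in> A then c Q * eval_mpoly (f Q) (coords Q) else 0)" if "A \<subseteq> S" "Q \<in> S" for A c Q
  proof -
    have fin: "finite A" using that S finite_subset by blast
    have "eval_mpoly (\<Sum>P\<in>A. const_mpoly (c P) * f P) (coords Q) =
        (\<Sum>P\<in>A. c P * eval_mpoly (f P) (coords Q))"
      by (simp add: eval_mpoly_sum eval_mpoly_mult)
    also have "\<dots> = (\<Sum>P\<in>A. if P = Q then c Q * eval_mpoly (f Q) (coords Q) else 0)"
      using that f(3) by (intro sum.cong) auto
    finally show ?thesis using fin by simp
  qed
  \<comment> \<open>Adding one point to \<open>A\<close> adds one class outside the span of the previous ones.\<close>
  have dim: "Q.dimension (card A) K (E A)" if "A \<subseteq> S" for A
    using finite_subset[OF that S(1)] that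
  proof (induction A)
    case empty
    have "E {} = {\<zero>\<^bsub>R Quot I\<^esub>}"
      using \<pi>.hom_zero by (auto simp: E_def)
    then show ?case by simp
  next
    case (insert P A)
    have "\<pi> (f P) \<notin> E A"
    proof
      assume "\<pi> (f P) \<in> E A"
      then obtain c where c: "f P - (\<Sum>Q\<in>A. const_mpoly (c Q) * f Q) \<in> I"
        by (auto simp: E_def \<pi>_eq_iff)
      have "P \<in> Z" using insert.prems S(2) by auto
      from vanishing_ideal_eval[OF c[unfolded I_def] this] show False
        using insert eval_comb[of A P c] f(2)[of P] by (simp add: eval_mpoly_diff)
    qed
    moreover have "Q.line_extension K (\<pi> (f P)) (E A) = E (insert P A)"
    proof -
      have step: "k x \<otimes>\<^bsub>R Quot I\<^esub> \<pi> (f P) \<oplus>\<^bsub>R Quot I\<^esub> \<pi> (\<Sum>Q\<in>A. const_mpoly (c Q) * f Q) =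
          \<pi> (\<Sum>Q\<in>insert P A. const_mpoly ((c(P := x)) Q) * f Q)" for x c
      proof -
        have "(\<Sum>Q\<in>A. const_mpoly ((c(P := x)) Q) * f Q) = (\<Sum>Q\<in>A. const_mpoly (c Q) * f Q)"
          using insert.hyps by (intro sum.cong) auto
        then show ?thesis
          using insert.hyps \<pi>.hom_mult[of "const_mpoly x" "f P"]
            \<pi>.hom_add[of "const_mpoly x * f P" "\<Sum>Q\<in>A. const_mpoly (c Q) * f Q"]
          by (simp add: k_def)
      qed
      show ?thesis
      proof (intro equalityI subsetI)
        fix u assume "u \<in> Q.line_extension K (\<pi> (f P)) (E A)"
        then obtain x c where "u = k x \<otimes>\<^bsub>R Quot I\<^esub> \<pi> (f P) \<oplus>\<^bsub>R Quot I\<^esub> \<pi> (\<Sum>Q\<in>A. const_mpoly (c Q) * f Q)"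
          unfolding Q.line_extension_mem_iff K_def E_def by blast
        then show "u \<in> E (insert P A)"
          unfolding step E_def by blast
      next
        fix u assume "u \<in> E (insert P A)"
        then obtain c where "u = \<pi> (\<Sum>Q\<in>insert P A. const_mpoly ((c(P := c P)) Q) * f Q)"
          unfolding E_def by auto
        then show "u \<in> Q.line_extension K (\<pi> (f P)) (E A)"
          unfolding Q.line_extension_mem_iff step[symmetric] K_def E_def by blast
      qed
    qed
    ultimately show ?case
      using Q.Suc_dim[of "\<pi> (f P)" "E A" "card A" K] insert \<pi>.hom_closed[of "f P"] by simp
  qed
  have "E S = \<pi> ` {g. homogeneous t g}"
  proof (intro equalityI subsetI)
    fix u assume "u \<in> E S"
    then show "u \<in> \<pi> ` {g. homogeneous t g}"
      unfolding E_def by (force intro!: homogeneous_sum homogeneous_scale f(1))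
  next
    fix u assume "u \<in> \<pi> ` {g. homogeneous t g}"
    then obtain g where g: "homogeneous t g" "u = \<pi> g" by blast
    \<comment> \<open>\<open>h\<close> is the Lagrange interpolation of \<open>g\<close> on \<open>S\<close>.\<close>
    define c where "c P = eval_mpoly g (coords P) / eval_mpoly (f P) (coords P)" for P
    define h where "h = (\<Sum>P\<in>S. const_mpoly (c P) * f P)"
    have "homogeneous t (g - h)"
      unfolding h_def by (intro homogeneous_diff g(1) homogeneous_sum homogeneous_scale f(1))
    moreover have "eval_mpoly (g - h) (coords Q) = 0" if "Q \<in> S" for Q
      using eval_comb[of S Q c] that f(2)[of Q] by (simp add: eval_mpoly_diff h_def c_def)
    ultimately have "g - h \<in> I"
      unfolding I_def using det by (blast intro: vanishing_idealI)
    then have "u = \<pi> h" by (simp add: g(2) \<pi>_eq_iff)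
    then show "u \<in> E S" by (auto simp: E_def h_def)
  qed
  then have "HF Z t = Q.dim K (E S)"
    by (simp add: hilbert_function_def Let_def R_def I_def \<pi>_def K_def k_def comp_def)
  also have "\<dots> = card S"
    using Q.dimI[OF K dim[OF order_refl]] by (simp add: over_def)
  finally show ?thesis .
qed

section \<open>Products of linear forms\<close>

definition pairing :: "('k::comm_ring_1) ^ ('n::finite) \<Rightarrow> 'k ^ 'n \<Rightarrow> 'k" where
  "pairing l v = (\<Sum>i\<in>UNIV. l $ i * v $ i)"

lemma pairing_zero_right: "pairing l 0 = 0"
  and pairing_add_right: "pairing l (v + w) = pairing l v + pairing l w"
  and pairing_scale_right: "pairing l (c *s v) = c * pairing l v"
  by (simp_all add: pairing_def distrib_left sum.distrib sum_distrib_left mult_ac)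

definition linear_form :: "('k::comm_ring_1) ^ ('n::finite) \<Rightarrow> ('n, 'k) mpoly" where
  "linear_form l = (\<Sum>i\<in>UNIV. Poly_Mapping.single (Poly_Mapping.single i 1) (l $ i))"

lemma monomial_value_single: "monomial_value (Poly_Mapping.single i 1) v = v $ i"
proof -
  have "monomial_value (Poly_Mapping.single i 1) v = (\<Prod>j\<in>UNIV. if j = i then v $ i else 1)"
    unfolding monomial_value_def by (intro prod.cong) (auto simp: lookup_single)
  then show ?thesis by simp
qed

lemma eval_linear_form: "eval_mpoly (linear_form l) v = pairing l v"
  by (simp add: linear_form_def pairing_def eval_mpoly_sum eval_mpoly_single monomial_value_single del: One_nat_def)

lemma homogeneous_linear_form:
  fixes l :: "'k::comm_ring_1 ^ 'n::finite"
  shows "homogeneous 1 (linear_form l)"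
  unfolding linear_form_def
proof (rule homogeneous_sum)
  have "(\<Sum>j\<in>UNIV. Poly_Mapping.lookup (Poly_Mapping.single i 1) j) = (1::nat)" for i :: 'n
    by (simp add: lookup_single when_def)
  then show "homogeneous 1 (Poly_Mapping.single (Poly_Mapping.single i 1) (l $ i))" for i
    by (simp add: homogeneous_def del: One_nat_def)
qed

lemma coords_Proj:
  assumes "v \<noteq> 0"
  obtains c where "c \<noteq> 0" "coords (Proj v) = c *s v"
  using Proj_eq_iff[OF assms coords_nonzero] Proj_coords by metis

lemma linear_form_separates:
  fixes P Q :: "('k::field, 'n::finite) proj"
  assumes "P \<noteq> Q"
  obtains l where "pairing l (coords P) \<noteq> 0" "pairing l (coords Q) = 0"
proof -
  let ?p = "coords P" and ?q = "coords Q"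
  have "wedge ?p ?q \<noteq> 0"
    using wedge_nonzero[of ?p ?q] assms by (simp add: coords_nonzero Proj_coords)
  then obtain i j where ij: "?p $ i * ?q $ j - ?p $ j * ?q $ i \<noteq> 0"
    by (auto simp: wedge_def vec_eq_iff)
  define l where "l = (\<chi> k. (if k = i then ?q $ j else 0) - (if k = j then ?q $ i else 0))"
  have "pairing l v = ?q $ j * v $ i - ?q $ i * v $ j" for v
    by (simp add: pairing_def l_def left_diff_distrib sum_subtractf mult_delta_left)
  with ij show thesis by (intro that[of l]) (simp_all add: mult.commute)
qed

lemma linear_form_nonzero_at:
  fixes P :: "('k::field, 'n::finite) proj"
  obtains l where "pairing l (coords P) \<noteq> 0"
proof -
  obtain i where "coords P $ i \<noteq> 0"
    using coords_nonzero[of P] by (auto simp: vec_eq_iff)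
  moreover have "pairing (axis i 1) (coords P) = coords P $ i"
    by (simp add: pairing_def axis_def mult_delta_left)
  ultimately show thesis using that by metis
qed

text \<open>
  One linear factor is spent on each point of \<open>S\<close>, and the remaining factors only have to be
  nonzero at \<open>P\<close>.  The factors are kept apart, rather than multiplied to a form, so that they can
  later be paired with the factors belonging to a point of a second line.
\<close>

lemma linear_forms_isolate_point:
  fixes P :: "('k::field, 'n::finite) proj"
  assumes S: "finite S" "P \<notin> S" "card S \<le> t"
  obtains l :: "nat \<Rightarrow> 'k ^ 'n" where
    "(\<Prod>i<t. pairing (l i) (coords P)) \<noteq> 0" "\<And>Q. Q \<in> S \<Longrightarrow> (\<Prod>i<t. pairing (l i) (coords Q)) = 0"
proof -
  obtain e where e: "bij_betw e {0..<card S} S"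
    using ex_bij_betw_nat_finite[OF S(1)] by blast
  have "\<exists>l. pairing l (coords P) \<noteq> 0 \<and> (i < card S \<longrightarrow> pairing l (coords (e i)) = 0)" for i
  proof (cases "i < card S")
    case True
    then have "P \<noteq> e i" using e S(2) by (auto simp: bij_betw_def)
    then show ?thesis using linear_form_separates by metis
  qed (use linear_form_nonzero_at in metis)
  then obtain l where l: "\<And>i. pairing (l i) (coords P) \<noteq> 0"
    "\<And>i. i < card S \<Longrightarrow> pairing (l i) (coords (e i)) = 0" by metis
  show thesis
  proof
    show "(\<Prod>i<t. pairing (l i) (coords P)) \<noteq> 0" using l(1) by simp
    fix Q assume "Q \<in> S"
    then obtain i where i: "i < card S" "Q = e i" using e by (force simp: bij_betw_def)
    then show "(\<Prod>i<t. pairing (l i) (coords Q)) = 0"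
      using l(2) S(3) by (intro prod_zero) (auto intro!: bexI[of _ i])
  qed
qed

section \<open>Finite sets of collinear points\<close>

lemma independent_if_distinct_points:
  fixes a b :: "'k::field ^ 'n::finite"
  assumes "a \<noteq> 0" "b \<noteq> 0" "Proj a \<noteq> Proj b"
  shows "vec.independent {a, b}"
proof -
  have "a \<notin> vec.span {b}"
  proof
    assume "a \<in> vec.span {b}"
    then obtain k where k: "a = k *s b" by (auto simp: vec.span_singleton)
    with assms(1) have "k \<noteq> 0" by auto
    with k assms Proj_eq_iff[of b a] show False by metis
  qed
  moreover have "a \<noteq> b" using assms(3) by auto
  ultimately show ?thesis
    using assms(2) by (simp add: vec.independent_insert)
qed

lemma plane_spanned_by:
  fixes V :: "('k::field ^ 'n::finite) set"
  assumes V: "vec.subspace V" "vec.dim V = 2" and ab: "a \<in> V" "b \<in> V" "a \<noteq> 0" "b \<noteq> 0" "Proj a \<noteq> Proj b"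
    and "v \<in> V"
  obtains s t where "v = s *s a + t *s b"
proof -
  have ne: "a \<noteq> b" using ab by auto
  have ind: "vec.independent {a, b}"
    using ab(3-5) by (rule independent_if_distinct_points)
  have "V \<subseteq> vec.span {a, b}"
    by (rule vec.card_ge_dim_independent[OF _ ind]) (use ab V ne in auto)
  with \<open>v \<in> V\<close> show thesis
    by (fastforce intro: that simp: vec.span_insert vec.span_singleton algebra_simps)
qed

lemma coords_in_plane:
  assumes "vec.subspace V" "P \<in> Proj ` (V - {0})"
  shows "coords P \<in> V"
  using Proj_in_line_iff[OF assms(1) coords_nonzero] assms(2) by (simp add: Proj_coords)

text \<open>
  A form of degree \<open>t\<close> restricts to a binary form of degree \<open>t\<close>, which has at most \<open>t\<close> zeros
  unless it is zero.  The factor \<open>w\<close> allows the same argument to be applied to the Hadamard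
  product of the line with a fixed point.
\<close>

lemma form_vanishes_on_line:
  fixes L :: "('k::field, 'n::finite) proj set"
  assumes L: "proj_line L" and f: "homogeneous t f"
    and S: "finite S" "S \<subseteq> L" "t < card S" "\<And>Q. Q \<in> S \<Longrightarrow> eval_mpoly f (w * coords Q) = 0"
    and P: "P \<in> L"
  shows "eval_mpoly f (w * coords P) = 0"
proof (cases "P \<in> S")
  case False
  obtain V where V: "vec.subspace V" "vec.dim V = 2" "L = Proj ` (V - {0})"
    using L unfolding proj_line_def by blast
  have in_V: "coords Q \<in> V" if "Q \<in> L" for Q
    using coords_in_plane V that by blast
  have "S \<noteq> {}" using S(3) by auto
  then obtain P0 where P0: "P0 \<in> S" by blast
  define p q where "p = coords P0" and "q = coords P"
  have pq: "p \<in> V" "q \<in> V" "p \<noteq> 0" "q \<noteq> 0" "Proj p \<noteq> Proj q"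
    using P0 P S(2) False in_V by (auto simp: p_def q_def coords_nonzero Proj_coords)
  \<comment> \<open>Let \<open>P\<close> be the point at infinity of an affine coordinate \<open>s\<close> on the line: the points of
    \<open>S\<close> then have finite coordinates, and the value at \<open>P\<close> is a leading coefficient.\<close>
  have "\<exists>u s. coords Q = u *s (p + s *s q) \<and> u \<noteq> 0" if Q: "Q \<in> S" for Q
  proof -
    obtain u s where us: "coords Q = u *s p + s *s q"
      using plane_spanned_by[OF V(1,2) pq in_V[of Q]] S(2) Q by blast
    have "u \<noteq> 0"
    proof
      assume "u = 0"
      with us have "coords Q = s *s q" by simp
      moreover from this have "s \<noteq> 0" using coords_nonzero[of Q] by auto
      ultimately have "Proj q = Proj (coords Q)"
        using Proj_eq_iff[of q "coords Q"] pq coords_nonzero by metis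
      with Q False show False by (simp add: q_def Proj_coords)
    qed
    with us have "coords Q = u *s (p + (s / u) *s q)"
      by (simp add: vec_eq_iff field_simps)
    with \<open>u \<noteq> 0\<close> show ?thesis by blast
  qed
  then obtain u s where us: "\<And>Q. Q \<in> S \<Longrightarrow> coords Q = u Q *s (p + s Q *s q)" "\<And>Q. Q \<in> S \<Longrightarrow> u Q \<noteq> 0"
    by metis
  obtain H where H: "Polynomial.degree H \<le> t" "poly.coeff H t = eval_mpoly f (w * q)"
    "\<And>s. poly H s = eval_mpoly f (w * p + s *s (w * q))"
    using homogeneous_on_line[OF f, where p = "w * p" and q = "w * q"] by blast
  have root: "poly H (s Q) = 0" if "Q \<in> S" for Q
  proof -
    have "w * coords Q = u Q *s (w * p + s Q *s (w * q))"
      using us(1)[OF that] by (simp add: vec_eq_iff algebra_simps)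
    then have "0 = u Q ^ t * poly H (s Q)"
      using S(4)[OF that] by (simp add: H(3) eval_mpoly_scale[OF f])
    with us(2)[OF that] show ?thesis by simp
  qed
  have "inj_on s S"
  proof (rule inj_onI)
    fix Q Q' assume Q: "Q \<in> S" "Q' \<in> S" "s Q = s Q'"
    then have "coords Q' = (u Q' / u Q) *s coords Q"
      using us by (simp add: vec_eq_iff)
    then have "Proj (coords Q) = Proj (coords Q')"
      using Proj_eq_iff[OF coords_nonzero coords_nonzero, of Q Q'] us(2) Q
      by (metis divide_eq_0_iff)
    then show "Q = Q'" by (simp add: Proj_coords)
  qed
  then have card: "card (s ` S) = card S" by (rule card_image)
  have "H = 0"
  proof (rule ccontr)
    assume "H \<noteq> 0"
    then have "card (s ` S) \<le> card {x. poly H x = 0}"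
      using root by (intro card_mono poly_roots_finite) auto
    also have "\<dots> \<le> Polynomial.degree H"
      using \<open>H \<noteq> 0\<close> by (rule card_poly_roots_bound)
    finally show False using H(1) S(3) card by simp
  qed
  with H(2) show ?thesis by (simp add: q_def)
qed (rule S(4))

lemma form_vanishes_on_collinear_set:
  fixes L :: "('k::field, 'n::finite) proj set"
  assumes L: "proj_line L" and Z: "finite Z" "Z \<subseteq> L" and S: "S \<subseteq> Z" "card S = min (Suc t) (card Z)"
    and f: "homogeneous t f" "\<And>Q. Q \<in> S \<Longrightarrow> eval_mpoly f (w * coords Q) = 0" and P: "P \<in> Z"
  shows "eval_mpoly f (w * coords P) = 0"
proof (cases "card Z \<le> t")
  case True
  then have "S = Z" using S Z by (intro card_subset_eq) auto
  with f P show ?thesis by simp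
next
  case False
  show ?thesis
    by (rule form_vanishes_on_line[OF L f(1), of S]) (use False S Z P f(2) finite_subset in auto)
qed

text \<open>
  A subset \<open>S\<close> of \<open>Z\<close> with \<open>min (t + 1) |Z|\<close> points is small enough for products of \<open>t\<close> linear
  forms to isolate its points, and large enough to force a form of degree \<open>t\<close> that vanishes on
  it to vanish on \<open>Z\<close>.
\<close>

lemma hilbert_function_on_line:
  fixes L :: "('k::field, 'n::finite) proj set"
  assumes L: "proj_line L" and Z: "finite Z" "Z \<subseteq> L" "Z \<noteq> {}"
  shows "HF Z t = min (Suc t) (card Z)"
proof -
  obtain S where S: "S \<subseteq> Z" "card S = min (Suc t) (card Z)" "finite S"
    using obtain_subset_with_card_n[of "min (Suc t) (card Z)" Z] by auto
  have "HF Z t = card S"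
  proof (rule hilbert_function_eq_card)
    fix P assume P: "P \<in> S"
    have "card (S - {P}) \<le> t" using P S by simp
    then obtain l where l: "(\<Prod>i<t. pairing (l i) (coords P)) \<noteq> 0"
      "\<And>Q. Q \<in> S - {P} \<Longrightarrow> (\<Prod>i<t. pairing (l i) (coords Q)) = 0"
      using linear_forms_isolate_point[of "S - {P}" P t] S(3) by blast
    have "homogeneous t (\<Prod>i<t. linear_form (l i))"
      using homogeneous_prod[OF finite_lessThan homogeneous_linear_form, of t l] by simp
    with l show "\<exists>f. homogeneous t f \<and> eval_mpoly f (coords P) \<noteq> 0 \<and>
        (\<forall>Q\<in>S - {P}. eval_mpoly f (coords Q) = 0)"
      by (intro exI[of _ "\<Prod>i<t. linear_form (l i)"]) (simp add: eval_mpoly_prod eval_linear_form)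
  next
    fix f P assume "homogeneous t f" "\<forall>Q\<in>S. eval_mpoly f (coords Q) = 0" "P \<in> Z"
    then show "eval_mpoly f (coords P) = 0"
      using form_vanishes_on_collinear_set[OF L Z(1,2) S(1,2), of f 1 P] by simp
  qed (use S Z in auto)
  with S show ?thesis by simp
qed

section \<open>Hadamard products of lines in Segre position\<close>

text \<open>
  This says that \<open>v \<otimes> w \<mapsto> v * w\<close> is injective on \<open>V \<otimes> V'\<close>, expressed by its dual: every
  product of linear forms on the two factors is the pullback of a linear form on the ambient
  space.  For planes \<open>V\<close> and \<open>V'\<close> the Hadamard product of the two lines is then a Segre
  embedding of their product.
\<close>

definition segre_independent :: "('k::field ^ 'n::finite) set \<Rightarrow> ('k ^ 'n) set \<Rightarrow> bool" where
  "segre_independent V V' \<longleftrightarrow>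
     (\<forall>l l'. \<exists>m. \<forall>v\<in>V. \<forall>w\<in>V'. pairing m (v * w) = pairing l v * pairing l' w)"

lemma segre_mult_nonzero:
  fixes V V' :: "('k::field ^ 'n::finite) set"
  assumes "segre_independent V V'" "coords P \<in> V" "coords Q \<in> V'"
  shows "coords P * coords Q \<noteq> 0"
proof -
  obtain l l' where "pairing l (coords P) \<noteq> 0" "pairing l' (coords Q) \<noteq> 0"
    using linear_form_nonzero_at by metis
  then have "\<exists>m. pairing m (coords P * coords Q) \<noteq> 0"
    using assms unfolding segre_independent_def by (metis no_zero_divisors)
  then show ?thesis using pairing_zero_right by metis
qed

lemma coords_hadamard:
  assumes "coords P * coords Q \<noteq> 0"
  obtains c where "c \<noteq> 0" "coords (hadamard P Q) = c *s (coords P * coords Q)"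
  using coords_Proj[OF assms] unfolding hadamard_def by blast

text \<open>
  Two points of the first line that differ are separated by a linear form \<open>l\<close>.  Its product with
  a linear form \<open>l'\<close> on the second line pulls back from the ambient space, so it separates the
  Hadamard products as well.
\<close>

lemma segre_inj:
  fixes V V' :: "('k::field ^ 'n::finite) set"
  assumes seg: "segre_independent V V'"
    and in_V: "coords P \<in> V" "coords Q \<in> V" and in_V': "coords P' \<in> V'" "coords Q' \<in> V'"
    and eq: "hadamard P P' = hadamard Q Q'"
  shows "P = Q" "P' = Q'"
proof -
  let ?x = "coords P * coords P'" and ?y = "coords Q * coords Q'"
  have "?x \<noteq> 0" "?y \<noteq> 0"
    using segre_mult_nonzero[OF seg] in_V in_V' by blast+
  with eq obtain c where c: "?y = c *s ?x"
    unfolding hadamard_def using Proj_eq_iff by metis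
  have prod: "pairing l (coords Q) * pairing l' (coords Q') = c * (pairing l (coords P) * pairing l' (coords P'))" for l l'
  proof -
    obtain m where m: "\<And>v w. v \<in> V \<Longrightarrow> w \<in> V' \<Longrightarrow> pairing m (v * w) = pairing l v * pairing l' w"
      using seg unfolding segre_independent_def by blast
    from arg_cong[OF c, of "pairing m"] show ?thesis
      using m in_V in_V' by (simp add: pairing_scale_right)
  qed
  show "P = Q"
  proof (rule ccontr)
    assume "P \<noteq> Q"
    then obtain l where "pairing l (coords Q) \<noteq> 0" "pairing l (coords P) = 0"
      using linear_form_separates[of Q P] by metis
    moreover obtain l' where "pairing l' (coords Q') \<noteq> 0"
      using linear_form_nonzero_at by metis
    ultimately show False using prod[of l l'] by simp
  qed
  show "P' = Q'"
  proof (rule ccontr)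
    assume "P' \<noteq> Q'"
    then obtain l' where "pairing l' (coords Q') \<noteq> 0" "pairing l' (coords P') = 0"
      using linear_form_separates[of Q' P'] by metis
    moreover obtain l where "pairing l (coords Q) \<noteq> 0"
      using linear_form_nonzero_at by metis
    ultimately show False using prod[of l l'] by simp
  qed
qed

locale segre_line_pair =
  fixes L L' :: "('k::field, 'n::finite) proj set" and V V' :: "('k ^ 'n) set"
  assumes V: "vec.subspace V" "vec.dim V = 2" "L = Proj ` (V - {0})"
    and V': "vec.subspace V'" "vec.dim V' = 2" "L' = Proj ` (V' - {0})"
    and seg: "segre_independent V V'"
begin

lemma lines: "proj_line L" "proj_line L'"
  using V V' by (auto simp: proj_line_def)

lemma in_V: "P \<in> L \<Longrightarrow> coords P \<in> V" and in_V': "P' \<in> L' \<Longrightarrow> coords P' \<in> V'"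
  using coords_in_plane V V' by blast+

lemma mult_nonzero: "P \<in> L \<Longrightarrow> P' \<in> L' \<Longrightarrow> coords P * coords P' \<noteq> 0"
  using segre_mult_nonzero[OF seg] in_V in_V' by blast

lemma hadamard_set_eq:
  assumes "Z \<subseteq> L" "Z' \<subseteq> L'"
  shows "Z \<star> Z' = case_prod hadamard ` (Z \<times> Z')"
  using assms mult_nonzero unfolding hadamard_set_def hadamard_defined_def by force

lemma card_hadamard_set:
  assumes "Z \<subseteq> L" "Z' \<subseteq> L'"
  shows "card (Z \<star> Z') = card Z * card Z'"
proof -
  have "inj_on (case_prod hadamard) (Z \<times> Z')"
    using assms segre_inj[OF seg in_V in_V in_V' in_V'] unfolding inj_on_def by (auto; meson subsetD)
  then show ?thesis
    by (simp add: hadamard_set_eq[OF assms] card_image card_cartesian_product)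
qed

text \<open>
  The interpolating subsets \<open>S\<close> and \<open>S'\<close> of the two factors give the interpolating subset
  \<open>S \<star> S'\<close>.  Its points are isolated by multiplying, factor by factor, the products of linear
  forms that isolate the points of \<open>S\<close> and \<open>S'\<close>.  A form of degree \<open>t\<close> that vanishes on
  \<open>S \<star> S'\<close> vanishes on \<open>Z \<star> S'\<close> by restriction to the lines \<open>L \<star> {Q'}\<close>, and then on
  \<open>Z \<star> Z'\<close> by restriction to the lines \<open>{P} \<star> L'\<close>.
\<close>

lemma hilbert_function_hadamard_set:
  assumes Z: "finite Z" "Z \<subseteq> L" "Z \<noteq> {}" and Z': "finite Z'" "Z' \<subseteq> L'" "Z' \<noteq> {}"
  shows "HF (Z \<star> Z') t = min (Suc t) (card Z) * min (Suc t) (card Z')"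
proof -
  obtain S where S: "S \<subseteq> Z" "card S = min (Suc t) (card Z)" "finite S"
    using obtain_subset_with_card_n[of "min (Suc t) (card Z)" Z] by auto
  obtain S' where S': "S' \<subseteq> Z'" "card S' = min (Suc t) (card Z')" "finite S'"
    using obtain_subset_with_card_n[of "min (Suc t) (card Z')" Z'] by auto
  have sub: "S \<subseteq> L" "S' \<subseteq> L'" using S S' Z Z' by auto
  have eval_iff: "eval_mpoly f (coords (hadamard P P')) = 0 \<longleftrightarrow> eval_mpoly f (coords P * coords P') = 0"
    if "homogeneous t f" "P \<in> L" "P' \<in> L'" for f P P'
    using coords_hadamard[OF mult_nonzero[OF that(2,3)]] eval_mpoly_scale[OF that(1)]
    by (metis mult_eq_0_iff power_not_zero)
  have "HF (Z \<star> Z') t = card (S \<star> S')"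
  proof (rule hilbert_function_eq_card)
    show "finite (S \<star> S')"
      using S S' by (simp add: hadamard_set_eq[OF sub])
    show "S \<star> S' \<subseteq> Z \<star> Z'"
      using S S' by (fastforce simp: hadamard_set_def)
    show "Z \<star> Z' \<noteq> {}"
      using Z Z' by (simp add: hadamard_set_eq)
  next
    fix T assume "T \<in> S \<star> S'"
    then obtain P P' where P: "P \<in> S" "P' \<in> S'" "T = hadamard P P'"
      by (auto simp: hadamard_set_eq[OF sub])
    have "card (S - {P}) \<le> t" "card (S' - {P'}) \<le> t" using P S S' by simp_all
    then obtain l l' where l: "(\<Prod>i<t. pairing (l i) (coords P)) \<noteq> 0"
      "\<And>Q. Q \<in> S - {P} \<Longrightarrow> (\<Prod>i<t. pairing (l i) (coords Q)) = 0"
      and l': "(\<Prod>i<t. pairing (l' i) (coords P')) \<noteq> 0"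
      "\<And>Q. Q \<in> S' - {P'} \<Longrightarrow> (\<Prod>i<t. pairing (l' i) (coords Q)) = 0"
      using linear_forms_isolate_point[of "S - {P}" P t] linear_forms_isolate_point[of "S' - {P'}" P' t]
        S(3) S'(3) by (metis Diff_iff finite_Diff singletonI)
    have "\<exists>m. \<forall>v\<in>V. \<forall>w\<in>V'. pairing m (v * w) = pairing (l i) v * pairing (l' i) w" for i
      using seg unfolding segre_independent_def by blast
    then obtain m where m: "\<And>i v w. v \<in> V \<Longrightarrow> w \<in> V' \<Longrightarrow> pairing (m i) (v * w) = pairing (l i) v * pairing (l' i) w"
      by metis
    define f where "f = (\<Prod>i<t. linear_form (m i))"
    have f: "homogeneous t f"
      using homogeneous_prod[OF finite_lessThan homogeneous_linear_form, of t m] by (simp add: f_def)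
    have f_eq: "eval_mpoly f (coords Q * coords Q') =
        (\<Prod>i<t. pairing (l i) (coords Q)) * (\<Prod>i<t. pairing (l' i) (coords Q'))" if "Q \<in> L" "Q' \<in> L'" for Q Q'
      using in_V[OF that(1)] in_V'[OF that(2)]
      by (simp add: f_def eval_mpoly_prod eval_linear_form m prod.distrib)
    have "eval_mpoly f (coords T) \<noteq> 0"
      using P sub l(1) l'(1) eval_iff[OF f] f_eq by (metis mult_eq_0_iff subsetD)
    moreover have "eval_mpoly f (coords T') = 0" if T': "T' \<in> S \<star> S' - {T}" for T'
    proof -
      obtain Q Q' where Q: "Q \<in> S" "Q' \<in> S'" "T' = hadamard Q Q'"
        using T' by (auto simp: hadamard_set_eq[OF sub])
      then have "Q \<in> S - {P} \<or> Q' \<in> S' - {P'}" using T' P by auto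
      then have "(\<Prod>i<t. pairing (l i) (coords Q)) * (\<Prod>i<t. pairing (l' i) (coords Q')) = 0"
        using l(2) l'(2) by (metis mult_eq_0_iff)
      moreover have "Q \<in> L" "Q' \<in> L'" using Q sub by auto
      ultimately show ?thesis
        using eval_iff[OF f, of Q Q'] f_eq[of Q Q'] Q(3) by metis
    qed
    ultimately show "\<exists>f. homogeneous t f \<and> eval_mpoly f (coords T) \<noteq> 0 \<and>
        (\<forall>T'\<in>S \<star> S' - {T}. eval_mpoly f (coords T') = 0)"
      using f by blast
  next
    fix f T assume f: "homogeneous t f" "\<forall>T\<in>S \<star> S'. eval_mpoly f (coords T) = 0" and "T \<in> Z \<star> Z'"
    then obtain P P' where P: "P \<in> Z" "P' \<in> Z'" "T = hadamard P P'"
      using Z Z' by (auto simp: hadamard_set_eq)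
    have 1: "eval_mpoly f (coords Q * coords Q') = 0" if "Q \<in> S" "Q' \<in> S'" for Q Q'
      using f that sub eval_iff[OF f(1), of Q Q'] by (auto simp: hadamard_set_eq[OF sub])
    have 2: "eval_mpoly f (coords P * coords Q') = 0" if "Q' \<in> S'" for Q'
      using form_vanishes_on_collinear_set[OF lines(1) Z(1,2) S(1,2) f(1) _ P(1), of "coords Q'"] 1[OF _ that]
      by (simp add: mult.commute)
    have "eval_mpoly f (coords P * coords P') = 0"
      using form_vanishes_on_collinear_set[OF lines(2) Z'(1,2) S'(1,2) f(1) _ P(2), of "coords P"] 2 by blast
    then show "eval_mpoly f (coords T) = 0"
      using eval_iff[OF f(1), of P P'] P Z Z' by auto
  qed
  then show ?thesis
    by (simp add: card_hadamard_set[OF sub] S(2) S'(2))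
qed

lemma regularity_index_hadamard_set:
  assumes Z: "finite Z" "Z \<subseteq> L" and Z': "finite Z'" "Z' \<subseteq> L'" and card: "card Z = m" "card Z' = m" "m \<ge> 1"
  shows "\<tau> (Z \<star> Z') = m - 1"
  unfolding regularity_index_def
proof (rule Least_equality)
  have ne: "Z \<noteq> {}" "Z' \<noteq> {}" using card by auto
  have eq: "HF (Z \<star> Z') t = min (Suc t) m * min (Suc t) m" for t
    using hilbert_function_hadamard_set[OF Z ne(1) Z' ne(2)] card by simp
  have card': "card (Z \<star> Z') = m * m"
    using card_hadamard_set[OF Z(2) Z'(2)] card by simp
  show "HF (Z \<star> Z') (m - 1) = card (Z \<star> Z')"
    using card(3) by (simp add: eq card')
  fix t assume "HF (Z \<star> Z') t = card (Z \<star> Z')"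
  then have "min (Suc t) m ^ 2 = m ^ 2" by (simp add: eq card' power2_eq_square)
  then have "min (Suc t) m = m" by (subst (asm) power2_eq_iff_nonneg) auto
  then show "m - 1 \<le> t" by simp
qed

end

section \<open>The open set of pairs of lines\<close>

text \<open>
  The coordinate planes cut each of the two lines in four points, and
  \<open>a\<^sub>i b\<^sub>j - a\<^sub>j b\<^sub>i\<close> is the homogeneous form of the difference of the \<open>i\<close>-th and the \<open>j\<close>-th of
  these points.  If all these differences are nonzero, this expression vanishes exactly if the two quadruples of points have the
  same cross ratio.  Up to sign it is the determinant of \<open>a * c\<close>, \<open>a * d\<close>, \<open>b * c\<close>, \<open>b * d\<close>
  in terms of the Pluecker coordinates of the lines through \<open>a, b\<close> and through \<open>c, d\<close>.
\<close>

definition cross_ratio_gap :: "'k::field ^ (4 \<times> 4) \<Rightarrow> 'k ^ (4 \<times> 4) \<Rightarrow> 'k" where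
  "cross_ratio_gap x y =
     x $ (1, 3) * x $ (2, 4) * (y $ (1, 4) * y $ (2, 3)) - x $ (1, 4) * x $ (2, 3) * (y $ (1, 3) * y $ (2, 4))"

lemma cross_ratio_gap_scale:
  "cross_ratio_gap (c *s x) (d *s y) = c\<^sup>2 * d\<^sup>2 * cross_ratio_gap x y"
  by (simp add: cross_ratio_gap_def power2_eq_square algebra_simps)

text \<open>
  The proof avoids expanding a determinant of order four.  A linear combination of the equations
  \<open>eq\<close> removes two of the four unknowns \<open>m\<^sub>i\<close> at a time; each pair of unknowns then
  satisfies two equations whose determinant is, up to sign, the given nonzero number.
\<close>

lemma segre_kernel_trivial:
  fixes a b c d m :: "'k::field ^ 4"
  assumes gap: "cross_ratio_gap (wedge a b) (wedge c d) \<noteq> 0"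
    and eq: "pairing m (a * c) = 0" "pairing m (a * d) = 0" "pairing m (b * c) = 0" "pairing m (b * d) = 0"
  shows "m = 0"
proof -
  define x where "x i j = a $ i * b $ j - a $ j * b $ i" for i j
  define y where "y i j = c $ i * d $ j - c $ j * d $ i" for i j
  \<comment> \<open>The terms with \<open>i = p\<close> and \<open>i = q\<close> vanish.\<close>
  have kill: "(\<Sum>i\<in>UNIV. m $ i * (x p i * y q i)) = 0" for p q
  proof -
    have "(\<Sum>i\<in>UNIV. m $ i * (x p i * y q i)) =
        b $ p * d $ q * pairing m (a * c) - b $ p * c $ q * pairing m (a * d)
        - a $ p * d $ q * pairing m (b * c) + a $ p * c $ q * pairing m (b * d)"
      by (simp add: pairing_def x_def y_def sum_4 algebra_simps)
    then show ?thesis by (simp add: eq)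
  qed
  have g: "x 1 3 * x 2 4 * (y 1 4 * y 2 3) - x 1 4 * x 2 3 * (y 1 3 * y 2 4) \<noteq> 0"
    using gap by (simp add: cross_ratio_gap_def wedge_def x_def y_def)
  have xy0: "x i i = 0" "y i i = 0" for i
    by (simp_all add: x_def y_def)
  have swap: "x 2 1 = - x 1 2" "x 3 1 = - x 1 3" "x 3 2 = - x 2 3" "x 4 1 = - x 1 4" "x 4 2 = - x 2 4"
    "y 2 1 = - y 1 2" "y 3 1 = - y 1 3" "y 3 2 = - y 2 3" "y 4 1 = - y 1 4" "y 4 2 = - y 2 4"
    by (simp_all add: x_def y_def)
  have e1: "m $ 3 * (x 1 3 * y 2 3) + m $ 4 * (x 1 4 * y 2 4) = 0"
    and e2: "m $ 3 * (x 2 3 * y 1 3) + m $ 4 * (x 2 4 * y 1 4) = 0"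
    and e3: "m $ 1 * (x 1 3 * y 1 4) + m $ 2 * (x 2 3 * y 2 4) = 0"
    and e4: "m $ 1 * (x 1 4 * y 1 3) + m $ 2 * (x 2 4 * y 2 3) = 0"
    using kill[of 1 2] kill[of 2 1] kill[of 3 4] kill[of 4 3] by (simp_all add: sum_4 xy0 swap)
  have cramer: "u * (p * s - q * r) = 0 \<and> v * (p * s - q * r) = 0"
    if "u * p + v * q = 0" "u * r + v * s = 0" for u v p q r s :: 'k
  proof -
    have "u * (p * s - q * r) = s * (u * p + v * q) - q * (u * r + v * s)"
      "v * (p * s - q * r) = p * (u * r + v * s) - r * (u * p + v * q)"
      by (simp_all add: algebra_simps)
    with that show ?thesis by simp
  qed
  have "m $ 1 = 0" "m $ 2 = 0" "m $ 3 = 0" "m $ 4 = 0"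
    using cramer[OF e1 e2] cramer[OF e3 e4] g by (auto simp: mult_ac)
  then show ?thesis by (simp add: vec_eq_iff forall_4)
qed

text \<open>
  The map \<open>m \<mapsto> (m(a * c), m(a * d), m(b * c), m(b * d))\<close> is an endomorphism of a space of
  dimension four with trivial kernel, hence surjective.
\<close>

lemma segre_interpolation:
  fixes a b c d :: "'k::field ^ 4"
  assumes gap: "cross_ratio_gap (wedge a b) (wedge c d) \<noteq> 0"
  obtains m where "pairing m (a * c) = \<alpha>" "pairing m (a * d) = \<beta>"
    "pairing m (b * c) = \<gamma>" "pairing m (b * d) = \<delta>"
proof -
  define e :: "4 \<Rightarrow> 'k ^ 4" where
    "e i = (if i = 1 then a * c else if i = 2 then a * d else if i = 3 then b * c else b * d)" for i
  define r :: "'k ^ 4" where "r = (\<chi> i. if i = 1 then \<alpha> else if i = 2 then \<beta> else if i = 3 then \<gamma> else \<delta>)"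
  define M :: "'k ^ 4 ^ 4" where "M = (\<chi> i. e i)"
  have M: "(M *v m) $ i = pairing m (e i)" for m i
    by (simp add: M_def matrix_vector_mult_def pairing_def mult.commute)
  have "m = 0" if "M *v m = 0" for m
  proof (rule segre_kernel_trivial[OF gap])
    have "pairing m (e i) = 0" for i
      using that M[of m i] by simp
    from this[of 1] this[of 2] this[of 3] this[of 4]
    show "pairing m (a * c) = 0" "pairing m (a * d) = 0" "pairing m (b * c) = 0" "pairing m (b * d) = 0"
      by (simp_all add: e_def)
  qed
  then obtain B where "B ** M = mat 1"
    using matrix_left_invertible_ker[of M] by blast
  then have "M ** B = mat 1"
    by (simp add: matrix_left_right_inverse)
  then have "M *v (B *v r) = r"
    by (simp add: matrix_vector_mul_assoc)
  then have "pairing (B *v r) (e i) = r $ i" for i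
    using M[of "B *v r" i] by simp
  from this[of 1] this[of 2] this[of 3] this[of 4] show thesis
    by (intro that[of "B *v r"]) (simp_all add: e_def r_def)
qed

lemma segre_independent_if_gap:
  fixes a b c d :: "'k::field ^ 4"
  assumes gap: "cross_ratio_gap (wedge a b) (wedge c d) \<noteq> 0"
    and V: "\<And>v. v \<in> V \<Longrightarrow> \<exists>s t. v = s *s a + t *s b" and V': "\<And>w. w \<in> V' \<Longrightarrow> \<exists>s t. w = s *s c + t *s d"
  shows "segre_independent V V'"
  unfolding segre_independent_def
proof (intro allI)
  fix l l' :: "'k ^ 4"
  obtain m where m: "pairing m (a * c) = pairing l a * pairing l' c" "pairing m (a * d) = pairing l a * pairing l' d"
    "pairing m (b * c) = pairing l b * pairing l' c" "pairing m (b * d) = pairing l b * pairing l' d"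
    using segre_interpolation[OF gap] by blast
  have "pairing m (v * w) = pairing l v * pairing l' w" if vw: "v \<in> V" "w \<in> V'" for v w
  proof -
    obtain s t s' t' where v: "v = s *s a + t *s b" and w: "w = s' *s c + t' *s d"
      using V[OF vw(1)] V'[OF vw(2)] by blast
    have "v * w = (s * s') *s (a * c) + (s * t') *s (a * d) + (t * s') *s (b * c) + (t * t') *s (b * d)"
      by (simp add: v w vec_eq_iff algebra_simps)
    then show ?thesis
      by (simp add: pairing_add_right pairing_scale_right m v w algebra_simps)
  qed
  then show "\<exists>m. \<forall>v\<in>V. \<forall>w\<in>V'. pairing m (v * w) = pairing l v * pairing l' w" by blast
qed

definition gap_form :: "((4 \<times> 4) + (4 \<times> 4), 'k::field) mpoly" where
  "gap_form = (let x = (\<lambda>i j. Poly_Mapping.single (Inl (i, j)) 1); y = (\<lambda>i j. Poly_Mapping.single (Inr (i, j)) 1)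
     in Poly_Mapping.single (x 1 3 + x 2 4 + (y 1 4 + y 2 3)) 1
        - Poly_Mapping.single (x 1 4 + x 2 3 + (y 1 3 + y 2 4)) 1)"

lemma eval_gap_form:
  "eval_mpoly gap_form (\<chi> i. case i of Inl j \<Rightarrow> x $ j | Inr j \<Rightarrow> y $ j) = cross_ratio_gap x y"
  by (simp add: gap_form_def Let_def eval_mpoly_diff eval_mpoly_single monomial_value_add
      monomial_value_single cross_ratio_gap_def del: One_nat_def)

lemma bihomogeneous_gap_form: "bihomogeneous 2 2 (gap_form :: ((4 \<times> 4) + (4 \<times> 4), 'k::field) mpoly)"
proof -
  have keys: "Poly_Mapping.keys (Poly_Mapping.single p 1 - Poly_Mapping.single q (1::'k)) \<subseteq> {p, q}" for p q :: "'z"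
    by (auto simp: in_keys_iff lookup_minus lookup_single when_def split: if_splits)
  have single: "(\<Sum>i\<in>UNIV. Poly_Mapping.lookup (Poly_Mapping.single (Inl p) 1) (Inl i)) = (1::nat)"
    "(\<Sum>i\<in>UNIV. Poly_Mapping.lookup (Poly_Mapping.single (Inr q) 1) (Inr i)) = (1::nat)"
    for p q :: "4 \<times> 4"
    by (simp_all add: lookup_single when_def)
  have zero: "Poly_Mapping.lookup (Poly_Mapping.single (Inl p) 1) (Inr i) = (0::nat)"
    "Poly_Mapping.lookup (Poly_Mapping.single (Inr p) 1) (Inl i) = (0::nat)" for p i :: "4 \<times> 4"
    by (simp_all add: lookup_single)
  show ?thesis
    unfolding gap_form_def Let_def bihomogeneous_def
    by (rule ballI, drule keys[THEN subsetD])
       (auto simp: lookup_add sum.distrib single zero simp del: One_nat_def)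
qed

lemma line_basis:
  fixes V :: "('k::field ^ 'n::finite) set"
  assumes "vec.subspace V" "vec.dim V = 2"
  obtains a b where "a \<in> V" "b \<in> V" "a \<noteq> 0" "b \<noteq> 0" "Proj a \<noteq> Proj b"
proof -
  obtain B where B: "B \<subseteq> V" "vec.independent B" "card B = 2"
    using vec.basis_exists[of V] assms(2) by metis
  then obtain a b where ab: "B = {a, b}" "a \<noteq> b" by (auto simp: card_2_iff)
  have nz: "a \<noteq> 0" "b \<noteq> 0" using B(2) ab vec.dependent_zero by blast+
  have "Proj a \<noteq> Proj b"
  proof
    assume "Proj a = Proj b"
    then obtain c where "a = c *s b"
      using Proj_eq_iff[OF nz(2,1)] by metis
    then have "a \<in> vec.span {b}" by (auto simp: vec.span_singleton)
    with B(2) ab show False by (simp add: vec.independent_insert)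
  qed
  with nz ab B(1) show thesis by (intro that[of a b]) auto
qed

lemma wedge_nonzeroD:
  assumes "wedge a b \<noteq> 0"
  shows "a \<noteq> 0" "b \<noteq> 0" "Proj a \<noteq> Proj b"
proof -
  show nz: "a \<noteq> 0" "b \<noteq> 0"
    by (rule notI, use assms in \<open>simp add: wedge_def vec_eq_iff\<close>)+
  show "Proj a \<noteq> Proj b"
  proof
    assume "Proj a = Proj b"
    then obtain c where "b = c *s a" using Proj_eq_iff[OF nz] by metis
    with assms show False by (simp add: wedge_def vec_eq_iff mult_ac)
  qed
qed

lemma proj_line_through:
  fixes a b :: "'k::field ^ 'n::finite"
  assumes "wedge a b \<noteq> 0"
  obtains L where "proj_line L" "Proj a \<in> L" "Proj b \<in> L"
proof -
  note ab = wedge_nonzeroD[OF assms]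
  have "vec.independent {a, b}" "a \<noteq> b"
    using independent_if_distinct_points[OF ab] ab(3) by auto
  then have "vec.dim (vec.span {a, b}) = 2"
    by (simp add: vec.dim_eq_card_independent)
  then show thesis
    using ab by (intro that[of "Proj ` (vec.span {a, b} - {0})"])
      (auto simp: proj_line_def vec.subspace_span intro!: vec.span_base exI[of _ "vec.span {a, b}"] imageI)
qed

lemma gap_pluecker:
  fixes L L' :: "('k::field, 4) proj set"
  assumes "proj_line L" "a \<noteq> 0" "b \<noteq> 0" "Proj a \<in> L" "Proj b \<in> L" "Proj a \<noteq> Proj b"
    and "proj_line L'" "c \<noteq> 0" "d \<noteq> 0" "Proj c \<in> L'" "Proj d \<in> L'" "Proj c \<noteq> Proj d"
  shows "vanishes_at2 gap_form (pluecker L, pluecker L') \<longleftrightarrow> cross_ratio_gap (wedge a b) (wedge c d) = 0"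
proof -
  obtain k where k: "k \<noteq> 0" "coords (pluecker L) = k *s wedge a b"
    using pluecker_eq[OF assms(1-6)] coords_Proj[OF wedge_nonzero[OF assms(2,3,6)]] by metis
  obtain k' where k': "k' \<noteq> 0" "coords (pluecker L') = k' *s wedge c d"
    using pluecker_eq[OF assms(7-12)] coords_Proj[OF wedge_nonzero[OF assms(8,9,12)]] by metis
  show ?thesis
    using k(1) k'(1) by (simp add: vanishes_at2_def eval_gap_form k(2) k'(2) cross_ratio_gap_scale)
qed

lemma zariski_open_in_self: "zariski_open_in L L"
proof -
  have "zariski_closed ({} :: ('k::field, 'n::finite) proj set)"
    unfolding zariski_closed_def
    by (intro exI[of _ "{const_mpoly 1}"]) (auto simp: vanishes_at_def intro: homogeneous_const)
  then show ?thesis unfolding zariski_open_in_def by (intro exI[of _ "{}"]) simp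
qed

definition segre_line_pairs :: "(('k::field, 4) proj set \<times> ('k, 4) proj set) set" where
  "segre_line_pairs = {(L, L'). proj_line L \<and> proj_line L' \<and> \<not> vanishes_at2 gap_form (pluecker L, pluecker L')}"

lemma zariski_open_segre_line_pairs: "zariski_open_line_pairs segre_line_pairs"
  unfolding zariski_open_line_pairs_def zariski_closed2_def segre_line_pairs_def
  using bihomogeneous_gap_form
  by (intro exI[of _ "{PQ. vanishes_at2 gap_form PQ}"] conjI exI[of _ "{gap_form}"]) auto

text \<open>
  The witness joins \<open>(1,0,1,0)\<close> to \<open>(0,1,0,1)\<close> and \<open>(1,1,0,0)\<close> to \<open>(0,0,1,1)\<close>.  The four
  Hadamard products of these vectors are the unit vectors.
\<close>

lemma segre_line_pairs_nonempty: "segre_line_pairs \<noteq> ({} :: (('k::field, 4) proj set \<times> ('k, 4) proj set) set)"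
proof -
  define a b c d :: "'k ^ 4" where
    "a = (\<chi> i. if i = 1 \<or> i = 3 then 1 else 0)" and "b = (\<chi> i. if i = 2 \<or> i = 4 then 1 else 0)" and
    "c = (\<chi> i. if i = 1 \<or> i = 2 then 1 else 0)" and "d = (\<chi> i. if i = 3 \<or> i = 4 then 1 else 0)"
  have gap: "cross_ratio_gap (wedge a b) (wedge c d) = 1"
    by (simp add: cross_ratio_gap_def wedge_def a_def b_def c_def d_def)
  then have w: "wedge a b \<noteq> 0" "wedge c d \<noteq> 0"
    by (auto simp: cross_ratio_gap_def)
  obtain L where L: "proj_line L" "Proj a \<in> L" "Proj b \<in> L" using proj_line_through[OF w(1)] .
  obtain L' where L': "proj_line L'" "Proj c \<in> L'" "Proj d \<in> L'" using proj_line_through[OF w(2)] .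
  have "(L, L') \<in> segre_line_pairs"
    using gap_pluecker[OF L(1) wedge_nonzeroD(1,2)[OF w(1)] L(2,3) wedge_nonzeroD(3)[OF w(1)]
        L'(1) wedge_nonzeroD(1,2)[OF w(2)] L'(2,3) wedge_nonzeroD(3)[OF w(2)]] gap L L'
    by (simp add: segre_line_pairs_def)
  then show ?thesis by blast
qed

lemma segre_line_pairsD:
  assumes "(L, L') \<in> segre_line_pairs"
  obtains V V' where "segre_line_pair L L' V V'"
proof -
  from assms have lines: "proj_line L" "proj_line L'" and
    nv: "\<not> vanishes_at2 gap_form (pluecker L, pluecker L')"
    by (auto simp: segre_line_pairs_def)
  obtain V where V: "vec.subspace V" "vec.dim V = 2" "L = Proj ` (V - {0})"
    using lines unfolding proj_line_def by blast
  obtain V' where V': "vec.subspace V'" "vec.dim V' = 2" "L' = Proj ` (V' - {0})"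
    using lines unfolding proj_line_def by blast
  obtain a b where ab: "a \<in> V" "b \<in> V" "a \<noteq> 0" "b \<noteq> 0" "Proj a \<noteq> Proj b"
    using line_basis[OF V(1,2)] .
  obtain c d where cd: "c \<in> V'" "d \<in> V'" "c \<noteq> 0" "d \<noteq> 0" "Proj c \<noteq> Proj d"
    using line_basis[OF V'(1,2)] .
  have "Proj a \<in> L" "Proj b \<in> L" "Proj c \<in> L'" "Proj d \<in> L'"
    using ab cd V V' by auto
  then have "cross_ratio_gap (wedge a b) (wedge c d) \<noteq> 0"
    using gap_pluecker[OF lines(1) ab(3,4) _ _ ab(5) lines(2) cd(3,4) _ _ cd(5)] nv by blast
  then have "segre_independent V V'"
    by (rule segre_independent_if_gap)
       (use plane_spanned_by[OF V(1,2) ab] plane_spanned_by[OF V'(1,2) cd] in blast)+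
  with V V' show thesis by (intro that[of V V']) (simp add: segre_line_pair_def)
qed

lemma proj_line_nonempty: "proj_line L \<Longrightarrow> L \<noteq> {}"
  unfolding proj_line_def using line_basis by (metis Diff_iff empty_iff image_eqI singletonD)

section \<open>The Hilbert function of a product of generic collinear sets\<close>

theorem theorem4p8:
  shows "\<exists>W :: (('k::alg_closed_field, 4) proj set \<times> ('k, 4) proj set) set.
    zariski_open_line_pairs W \<and> W \<noteq> {} \<and>
    (\<forall>L L'. (L, L') \<in> W \<and> L \<noteq> L' \<longrightarrow>
      (\<exists>U. zariski_open_in L U \<and> U \<noteq> {} \<and>
        (\<forall>Z. finite Z \<and> Z \<subseteq> U \<and> card Z \<ge> 2 \<longrightarrow>
          (\<exists>U'. zariski_open_in L' U' \<and> U' \<noteq> {} \<and>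
            (\<forall>Z' m. finite Z' \<and> Z' \<subseteq> U' \<and> card Z' = m \<and> card Z = m \<longrightarrow>
              \<tau> (Z \<star> Z') = m - 1 \<and>
              (\<forall>t. HF (Z \<star> Z') t = HF Z t * HF Z' t))))))"
proof (intro exI[of _ segre_line_pairs] conjI allI impI)
  fix L L' :: "('k, 4) proj set"
  assume "(L, L') \<in> segre_line_pairs \<and> L \<noteq> L'"
  then obtain V V' where "segre_line_pair L L' V V'"
    using segre_line_pairsD by blast
  then interpret segre_line_pair L L' V V' .
  show "\<exists>U. zariski_open_in L U \<and> U \<noteq> {} \<and>
        (\<forall>Z. finite Z \<and> Z \<subseteq> U \<and> card Z \<ge> 2 \<longrightarrow>
          (\<exists>U'. zariski_open_in L' U' \<and> U' \<noteq> {} \<and>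
            (\<forall>Z' m. finite Z' \<and> Z' \<subseteq> U' \<and> card Z' = m \<and> card Z = m \<longrightarrow>
              \<tau> (Z \<star> Z') = m - 1 \<and>
              (\<forall>t. HF (Z \<star> Z') t = HF Z t * HF Z' t))))"
  proof (rule exI[of _ L], intro conjI allI impI, goal_cases)
    case 1
    show ?case by (rule zariski_open_in_self)
  next
    case 2
    show ?case using lines(1) by (rule proj_line_nonempty)
  next
    case Z: (3 Z)
    show ?case
    proof (rule exI[of _ L'], intro conjI allI impI)
      show "zariski_open_in L' L'" by (rule zariski_open_in_self)
      show "L' \<noteq> {}" using lines(2) by (rule proj_line_nonempty)
      fix Z' m
      assume Z': "finite Z' \<and> Z' \<subseteq> L' \<and> card Z' = m \<and> card Z = m"
      with Z have ne: "Z \<noteq> {}" "Z' \<noteq> {}" by auto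
      show "\<tau> (Z \<star> Z') = m - 1"
        using Z Z' by (intro regularity_index_hadamard_set) auto
      show "HF (Z \<star> Z') t = HF Z t * HF Z' t" for t
        using Z Z' ne hilbert_function_hadamard_set[of Z Z' t]
          hilbert_function_on_line[OF lines(1), of Z t] hilbert_function_on_line[OF lines(2), of Z' t]
        by simp
    qed
  qed
qed (rule zariski_open_segre_line_pairs segre_line_pairs_nonempty)+

end
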